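(* Let $m\ge1$ and $\kappa_m=\sqrt{\ln(4m)/\pi}$. The average number of edges of the minimal dag of an $m$-labeled unranked tree of size $n$, taken uniformly at random, satisfies $$\bar E^{\mathcal T}_{m,n}=3\kappa_m\frac{n}{\sqrt{\ln n}}\left(1+O\!\left(\frac1{\ln n}\right)\right)\quad(n\to\infty).$$
   Context: An $m$-labeled unranked tree is a non-empty finite rooted tree with node labels in $\{1,\dots,m\}$ and linearly ordered children (any finite number); its size is its number of edges. Its minimal dag has one node per distinct subtree (subtree = a node with all its descendants), and the node of a subtree $f(s_1,\dots,s_k)$ has $k$ ordered edges to the nodes of $s_1,\dots,s_k$; its number of edges is thus the sum over distinct subtrees of the number of children of their root. $\bar E^{\mathcal T}_{m,n}$ is the average of this number over all $m$-labeled unranked trees of size $n$. *)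

theory Defs
  imports Complex_Main "HOL-Library.Landau_Symbols"
begin

datatype utree = Node nat "utree list"

fun children :: "utree \<Rightarrow> utree list" where
  "children (Node a ts) = ts"

fun labels_in :: "nat \<Rightarrow> utree \<Rightarrow> bool" where
  "labels_in m (Node a ts) = (a \<in> {1..m} \<and> (\<forall>t\<in>set ts. labels_in m t))"

fun tree_size :: "utree \<Rightarrow> nat" where
  "tree_size (Node a ts) = length ts + sum_list (map tree_size ts)"

fun subtrees :: "utree \<Rightarrow> utree set" where
  "subtrees (Node a ts) = insert (Node a ts) (\<Union>t\<in>set ts. subtrees t)"

text \<open>Number of edges of the minimal dag: sum over distinct subtrees of the
  number of children of their root.\<close>
definition dag_edges :: "utree \<Rightarrow> nat" where
  "dag_edges t = (\<Sum>s\<in>subtrees t. length (children s))"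

definition trees_of_size :: "nat \<Rightarrow> nat \<Rightarrow> utree set" where
  "trees_of_size m n = {t. labels_in m t \<and> tree_size t = n}"

definition avg_dag_edges :: "nat \<Rightarrow> nat \<Rightarrow> real" where
  "avg_dag_edges m n =
     (\<Sum>t\<in>trees_of_size m n. real (dag_edges t)) / real (card (trees_of_size m n))"

definition kappa :: "nat \<Rightarrow> real" where
  "kappa m = sqrt (ln (4 * real m) / pi)"

end

theory Submission
  imports Defs "HOL-Analysis.Gamma_Function" "HOL-Computational_Algebra.Formal_Power_Series"
    "HOL-Real_Asymp.Real_Asymp"
begin

text \<open>
  Cut at the size \<open>K = \<lfloor>log\<^bsub>4m\<^esub> n\<rfloor>\<close>. The roots of all trees of size at most \<open>K\<close> have only
  \<open>O(n / (ln n)\<^bsup>3/2\<^esup>)\<close> children in total. A tree larger than \<open>K\<close> occurs in a random tree of size \<open>n\<close>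
  so rarely that, up to the same error, it may be counted with multiplicity: by Bonferroni, the
  error is at most the expected number of ordered pairs of distinct occurrences. With multiplicity the total number of edges is exactly \<open>n\<close>, so
  the main term is \<open>n\<close> minus the edges below occurrences of trees of size at most \<open>K\<close>. Writing
  \<open>b\<^sub>k\<close> for \<open>(2k choose k) / 4^k\<close>, the sum of these telescopes to \<open>n (1 - 4 b\<^bsub>K+2\<^esub> + b\<^bsub>K+1\<^esub>) + O(K)\<close>,
  and Wallis' product gives \<open>b\<^sub>k \<approx> 1 / sqrt (\<pi> k)\<close>.

  The generating functions of occurrences and of pairs of occurrences of a fixed tree depend only
  on its size, and all of them are expressible through \<open>1 / sqrt (1 - 4 m z)\<close>.
\<close>

unbundle no vec_syntax
unbundle fps_syntax

section \<open>Binary decomposition of plane trees\<close>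

text \<open>Grafting makes plane trees into binary ones: every tree that is not a single node is
  uniquely a graft of its first child and the rest.\<close>

fun graft :: "utree \<Rightarrow> utree \<Rightarrow> utree" where
  "graft x (Node a ts) = Node a (x # ts)"

lemma tree_size_graft [simp]: "tree_size (graft x y) = Suc (tree_size x + tree_size y)"
  by (cases y) simp

lemma labels_in_graft [simp]: "labels_in m (graft x y) \<longleftrightarrow> labels_in m x \<and> labels_in m y"
  by (cases y) auto

lemma graft_inject [simp]: "graft x y = graft x' y' \<longleftrightarrow> x = x' \<and> y = y'"
  by (cases y; cases y') auto

lemma utree_cases_graft:
  obtains (leaf) a where "t = Node a []" | (graft) x y where "t = graft x y"
proof -
  obtain a ts where t: "t = Node a ts"
    by (cases t)
  show ?thesis
  proof (cases ts)
    case Nil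
    then show ?thesis using t leaf by simp
  next
    case (Cons x xs)
    then show ?thesis using t graft[of x "Node a xs"] by simp
  qed
qed

text \<open>Both parts of a graft are smaller than the whole, so this binary induction replaces the
  nested one over lists of children.\<close>

lemma utree_graft_induct [case_names leaf graft]:
  assumes "\<And>a. P (Node a [])" and "\<And>x y. P x \<Longrightarrow> P y \<Longrightarrow> P (graft x y)"
  shows "P t"
proof (induction t rule: measure_induct_rule[where f = tree_size])
  case (less t)
  show ?case
    using less by (cases t rule: utree_cases_graft) (auto intro: assms)
qed

lemma trees_of_size_0: "trees_of_size m 0 = (\<lambda>a. Node a []) ` {1..m}"
proof -
  have "t \<in> (\<lambda>a. Node a []) ` {1..m}" if "t \<in> trees_of_size m 0" for t
    using that by (cases t rule: utree_cases_graft) (auto simp: trees_of_size_def)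
  then show ?thesis by (auto simp: trees_of_size_def)
qed

lemma trees_of_size_Suc:
  "trees_of_size m (Suc n) =
    (\<Union>i\<le>n. (\<lambda>(x, y). graft x y) ` (trees_of_size m i \<times> trees_of_size m (n - i)))"
  (is "_ = ?R")
proof -
  have "t \<in> ?R" if "t \<in> trees_of_size m (Suc n)" for t
  proof (cases t rule: utree_cases_graft)
    case (leaf a)
    then show ?thesis using that by (auto simp: trees_of_size_def)
  next
    case (graft x y)
    then have "labels_in m x" "labels_in m y" "tree_size x + tree_size y = n"
      using that by (auto simp: trees_of_size_def)
    then have "(x, y) \<in> trees_of_size m (tree_size x) \<times> trees_of_size m (n - tree_size x)"
      "tree_size x \<le> n"
      by (auto simp: trees_of_size_def)
    then show ?thesis using graft by force
  qed
  moreover have "t \<in> trees_of_size m (Suc n)" if "t \<in> ?R" for t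
    using that by (auto simp: trees_of_size_def)
  ultimately show ?thesis by blast
qed

lemma finite_trees_of_size [simp]: "finite (trees_of_size m n)"
proof (induction n rule: less_induct)
  case (less n)
  show ?case
    by (cases n) (auto simp: trees_of_size_0 trees_of_size_Suc less)
qed

text \<open>The decomposition is unique, and the size \<open>i\<close> of the first child separates
  the classes; the successor accounts for the edge to that child.\<close>

lemma sum_trees_of_size_Suc:
  fixes w :: "utree \<Rightarrow> real"
  shows "(\<Sum>t\<in>trees_of_size m (Suc n). w t) =
    (\<Sum>i\<le>n. \<Sum>x\<in>trees_of_size m i. \<Sum>y\<in>trees_of_size m (n - i). w (graft x y))"
proof -
  have "(\<Sum>t\<in>trees_of_size m (Suc n). w t) =
      (\<Sum>i\<le>n. \<Sum>t\<in>(\<lambda>(x, y). graft x y) ` (trees_of_size m i \<times> trees_of_size m (n - i)). w t)"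
    unfolding trees_of_size_Suc
    by (rule sum.UNION_disjoint) (auto, auto simp: trees_of_size_def)
  also have "\<dots> = (\<Sum>i\<le>n. \<Sum>(x, y)\<in>trees_of_size m i \<times> trees_of_size m (n - i). w (graft x y))"
    by (intro sum.cong refl, subst sum.reindex) (auto simp: inj_on_def case_prod_unfold)
  finally show ?thesis
    by (simp add: sum.cartesian_product)
qed

section \<open>Generating functions\<close>

definition tree_gf :: "nat \<Rightarrow> (utree \<Rightarrow> real) \<Rightarrow> real fps" where
  "tree_gf m w = Abs_fps (\<lambda>n. \<Sum>t\<in>trees_of_size m n. w t)"

lemma tree_gf_nth: "tree_gf m w $ n = (\<Sum>t\<in>trees_of_size m n. w t)"
  by (simp add: tree_gf_def)

lemma tree_gf_add: "tree_gf m (\<lambda>t. u t + v t) = tree_gf m u + tree_gf m v"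
  by (simp add: fps_eq_iff tree_gf_nth sum.distrib)

lemma tree_gf_mult_nth:
  "(tree_gf m u * tree_gf m v) $ n =
    (\<Sum>i\<le>n. \<Sum>x\<in>trees_of_size m i. \<Sum>y\<in>trees_of_size m (n - i). u x * v y)"
  by (simp add: fps_mult_nth tree_gf_nth sum_product atLeast0AtMost)

text \<open>Grafting becomes multiplication: a weight that splits into \<open>l\<close> products
  satisfies a functional equation, with \<open>fps_X\<close> for the edge to the first child and the
  single-node trees as constant term.\<close>

lemma tree_gf_graft:
  assumes "\<And>x y. w (graft x y) = (\<Sum>j<(l::nat). u j x * v j y)"
  shows "tree_gf m w = fps_const (\<Sum>t\<in>trees_of_size m 0. w t) +
    fps_X * (\<Sum>j<l. tree_gf m (u j) * tree_gf m (v j))"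
proof (rule fps_ext)
  fix n
  show "tree_gf m w $ n = (fps_const (\<Sum>t\<in>trees_of_size m 0. w t) +
    fps_X * (\<Sum>j<l. tree_gf m (u j) * tree_gf m (v j))) $ n"
  proof (cases n)
    case 0
    then show ?thesis by (simp add: tree_gf_nth)
  next
    case (Suc k)
    have "tree_gf m w $ Suc k = (\<Sum>j<l. (tree_gf m (u j) * tree_gf m (v j)) $ k)"
      unfolding tree_gf_nth sum_trees_of_size_Suc tree_gf_mult_nth assms
      by (simp only: sum.swap[of _ _ "{..<l}"])
    then show ?thesis using Suc by (simp add: fps_sum_nth)
  qed
qed

section \<open>Occurrences of a fixed tree as a subtree\<close>

fun nodes :: "utree \<Rightarrow> utree list" where
  "nodes (Node a ts) = Node a ts # concat (map nodes ts)"

text \<open>The subtrees at all nodes but the root. Unlike \<open>nodes\<close>, this list is additive under grafting.\<close>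

definition inner :: "utree \<Rightarrow> utree list" where
  "inner t = concat (map nodes (children t))"

lemma nodes_eq: "nodes t = t # inner t"
  by (cases t) (simp add: inner_def)

lemma inner_leaf [simp]: "inner (Node a []) = []"
  by (simp add: inner_def)

lemma inner_graft [simp]: "inner (graft x y) = nodes x @ inner y"
  by (cases y) (simp add: inner_def)

lemma children_graft [simp]: "children (graft x y) = x # children y"
  by (cases y) simp

lemma set_nodes: "set (nodes t) = subtrees t"
  by (induction t rule: nodes.induct) auto

text \<open>Every edge is counted exactly once, at its upper end.\<close>

lemma sum_list_degrees: "sum_list (map (\<lambda>s. length (children s)) (nodes t)) = tree_size t"
  by (induction t rule: utree_graft_induct) (simp_all add: nodes_eq)

lemma inner_size: "s \<in> set (inner t) \<Longrightarrow> tree_size s < tree_size t"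
  by (induction t rule: utree_graft_induct) (fastforce simp: nodes_eq)+

lemma inner_labels: "s \<in> set (inner t) \<Longrightarrow> labels_in m t \<Longrightarrow> labels_in m s"
  by (induction t rule: utree_graft_induct) (auto simp: nodes_eq)

lemma subtrees_in_trees:
  assumes "t \<in> trees_of_size m n" "s \<in> subtrees t"
  shows "s \<in> (\<Union>k\<le>n. trees_of_size m k)"
  using assms inner_size[of s t] inner_labels[of s t m]
  by (auto simp: nodes_eq trees_of_size_def simp flip: set_nodes)

definition occ :: "utree \<Rightarrow> utree \<Rightarrow> real" where
  "occ s t = real (count_list (nodes t) s)"

definition inner_occ :: "utree \<Rightarrow> utree \<Rightarrow> real" where
  "inner_occ s t = real (count_list (inner t) s)"

lemma occ_eq: "occ s t = inner_occ s t + (if t = s then 1 else 0)"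
  by (simp add: occ_def inner_occ_def nodes_eq)

lemma inner_occ_leaf [simp]: "inner_occ s (Node a []) = 0"
  by (simp add: inner_occ_def)

lemma inner_occ_graft [simp]: "inner_occ s (graft x y) = occ s x + inner_occ s y"
  by (simp add: occ_def inner_occ_def)

lemma inner_occ_self: "inner_occ s s = 0"
  using inner_size[of s s] by (auto simp: inner_occ_def count_list_0_iff)

text \<open>The two counts differ only at \<open>t = s\<close>, where they are 1 and 0 because a
  proper subtree is smaller; both products vanish there. So pairs may be counted through
  \<open>inner_occ\<close>, which is additive under grafting.\<close>

lemma occ_pairs: "occ s t * (occ s t - 1) = inner_occ s t * (inner_occ s t - 1)"
  by (simp add: occ_eq inner_occ_self)

section \<open>Functional equations of the generating functions\<close>

lemma tree_gf_one:
  fixes m :: nat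
  defines "T \<equiv> tree_gf m (\<lambda>_. 1)"
  shows "T = fps_const (real m) + fps_X * (T * T)"
proof -
  have "real (card (trees_of_size m 0)) = real m"
    by (simp add: trees_of_size_0 card_image inj_on_def)
  then show ?thesis
    using tree_gf_graft[where w = "\<lambda>_. 1" and l = "Suc 0" and m = m
        and u = "\<lambda>_ _. 1" and v = "\<lambda>_ _. 1"] by (simp add: T_def)
qed

text \<open>Grafting adds 1 to the root degree of \<open>y\<close>: the 1 gives
  \<open>T * T\<close>, the old degree gives \<open>T * D\<close>.\<close>

lemma tree_gf_degree:
  fixes m :: nat
  defines "T \<equiv> tree_gf m (\<lambda>_. 1)" and "D \<equiv> tree_gf m (\<lambda>t. real (length (children t)))"
  shows "D = fps_X * (T * T + T * D)"
proof -
  have "(\<Sum>t\<in>trees_of_size m 0. real (length (children t))) = 0"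
    by (rule sum.neutral) (auto simp: trees_of_size_0)
  then show ?thesis
    using tree_gf_graft[where w = "\<lambda>t. real (length (children t))" and l = 2 and m = m
        and u = "\<lambda>_ _. 1"
        and v = "\<lambda>j t. if j = 0 then 1 else real (length (children t))"]
    by (simp add: T_def D_def numeral_2_eq_2)
qed

text \<open>Only \<open>s\<close> itself has \<open>s\<close> at the root, whence the single
  monomial.\<close>

lemma tree_gf_occ:
  assumes "s \<in> trees_of_size m k"
  shows "tree_gf m (occ s) = tree_gf m (inner_occ s) + fps_X ^ k"
proof -
  have "s \<in> trees_of_size m n \<longleftrightarrow> n = k" for n
    using assms by (auto simp: trees_of_size_def)
  then have "(\<Sum>t\<in>trees_of_size m n. if t = s then 1 else 0) = (if n = k then 1 else (0::real))" for n
    by simp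
  then have "tree_gf m (\<lambda>t. if t = s then 1 else 0) = fps_X ^ k"
    by (simp add: fps_eq_iff tree_gf_nth fps_X_power_nth)
  then show ?thesis
    unfolding occ_eq[abs_def] tree_gf_add by simp
qed

lemma tree_gf_inner_occ:
  fixes m :: nat
  defines "T \<equiv> tree_gf m (\<lambda>_. 1)"
  shows "tree_gf m (inner_occ s) = fps_X * (tree_gf m (occ s) * T + T * tree_gf m (inner_occ s))"
proof -
  have "(\<Sum>t\<in>trees_of_size m 0. inner_occ s t) = 0"
    by (rule sum.neutral) (auto simp: trees_of_size_0)
  then show ?thesis
    using tree_gf_graft[where w = "inner_occ s" and l = 2 and m = m
        and u = "\<lambda>j. if j = 0 then occ s else (\<lambda>_. 1)"
        and v = "\<lambda>j. if j = 0 then (\<lambda>_. 1) else inner_occ s"]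
    by (simp add: T_def numeral_2_eq_2)
qed

lemma tree_gf_pairs:
  fixes m :: nat and s :: utree
  defines "T \<equiv> tree_gf m (\<lambda>_. 1)" and "P \<equiv> tree_gf m (\<lambda>t. occ s t * (occ s t - 1))"
  shows "P = fps_X * (P * T + T * P + 2 * (tree_gf m (occ s) * tree_gf m (inner_occ s)))"
proof -
  have P: "P = tree_gf m (\<lambda>t. inner_occ s t * (inner_occ s t - 1))"
    by (simp add: P_def occ_pairs)
  have 0: "(\<Sum>t\<in>trees_of_size m 0. inner_occ s t * (inner_occ s t - 1)) = 0"
    by (rule sum.neutral) (auto simp: trees_of_size_0)
  \<comment> \<open>The identity \<open>(a + b)(a + b - 1) = a(a - 1) + b(b - 1) + 2ab\<close>, with
    the cross term written twice so that every summand is a plain product; hence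
    \<open>l = 4\<close> below.\<close>
  have "inner_occ s (graft x y) * (inner_occ s (graft x y) - 1) =
      occ s x * (occ s x - 1) * 1 + 1 * (inner_occ s y * (inner_occ s y - 1)) +
      occ s x * inner_occ s y + occ s x * inner_occ s y" for x y
    by (simp add: algebra_simps)
  then show ?thesis
    using tree_gf_graft[where w = "\<lambda>t. inner_occ s t * (inner_occ s t - 1)" and l = 4 and m = m
        and u = "\<lambda>j. if j = 0 then (\<lambda>t. occ s t * (occ s t - 1)) else if j = 1 then (\<lambda>_. 1) else occ s"
        and v = "\<lambda>j. if j = 0 then (\<lambda>_. 1) else if j = 1 then (\<lambda>t. inner_occ s t * (inner_occ s t - 1))
          else inner_occ s"]
    by (simp add: T_def 0 eval_nat_numeral flip: P P_def) (simp add: algebra_simps)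
qed

section \<open>Central binomial coefficients\<close>

text \<open>The normalised central binomial coefficient \<open>(2n choose n) / 4^n\<close>.\<close>

definition cb :: "nat \<Rightarrow> real" where
  "cb n = (\<Prod>i<n. (2 * real i + 1) / (2 * real i + 2))"

lemma cb_0 [simp]: "cb 0 = 1"
  by (simp add: cb_def)

lemma cb_Suc: "cb (Suc n) = cb n * (2 * real n + 1) / (2 * real n + 2)"
  by (simp add: cb_def)

lemma cb_pos [simp]: "cb n > 0"
  by (induction n) (auto simp: cb_Suc)

lemma cb_neq_0 [simp]: "cb n \<noteq> 0"
  using cb_pos[of n] by linarith

lemma cb_sq_Suc: "(2 * real n + 2)\<^sup>2 * (cb (Suc n))\<^sup>2 = (2 * real n + 1)\<^sup>2 * (cb n)\<^sup>2"
  by (simp add: cb_Suc power_divide power_mult_distrib)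

text \<open>Cancelling common factors leaves \<open>4n(n + 1) <= (2n + 1)^2\<close>. This increasing
  sequence and the decreasing one below have limits known from Wallis' product, which gives explicit
  bounds on \<open>cb n\<close> from both sides.\<close>

lemma cb_sq_mono: "incseq (\<lambda>n. real n * (cb n)\<^sup>2)"
proof (rule incseq_SucI)
  fix n
  have "real n * (cb n)\<^sup>2 * (2 * real n + 2)\<^sup>2 \<le> real (Suc n) * (2 * real n + 1)\<^sup>2 * (cb n)\<^sup>2"
    using mult_right_mono[of "real n * (2 * real n + 2)\<^sup>2" "real (Suc n) * (2 * real n + 1)\<^sup>2" "(cb n)\<^sup>2"]
    by (simp add: algebra_simps power2_eq_square)
  then have "real n * (cb n)\<^sup>2 * (2 * real n + 2)\<^sup>2 \<le> (real (Suc n) * (cb (Suc n))\<^sup>2) * (2 * real n + 2)\<^sup>2"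
    using cb_sq_Suc[of n] by (simp add: algebra_simps)
  then show "real n * (cb n)\<^sup>2 \<le> real (Suc n) * (cb (Suc n))\<^sup>2"
    by (rule mult_right_le_imp_le) simp
qed

text \<open>The quotient of consecutive terms is
  \<open>(2n + 1)(2n + 3) / (2n + 2)^2 < 1\<close>.\<close>

lemma cb_sq_antimono: "decseq (\<lambda>n. (2 * real n + 1) * (cb n)\<^sup>2)"
proof (rule decseq_SucI)
  fix n
  have "(2 * real n + 3) * (2 * real n + 1)\<^sup>2 * (cb n)\<^sup>2 \<le> (2 * real n + 1) * (2 * real n + 2)\<^sup>2 * (cb n)\<^sup>2"
    by (rule mult_right_mono) (simp_all add: algebra_simps power2_eq_square)
  then have "((2 * real n + 3) * (cb (Suc n))\<^sup>2) * (2 * real n + 2)\<^sup>2 \<le>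
      ((2 * real n + 1) * (cb n)\<^sup>2) * (2 * real n + 2)\<^sup>2"
    using cb_sq_Suc[of n] by (simp add: algebra_simps)
  then have "(2 * real n + 3) * (cb (Suc n))\<^sup>2 \<le> (2 * real n + 1) * (cb n)\<^sup>2"
    by (rule mult_right_le_imp_le) simp
  then show "(2 * real (Suc n) + 1) * (cb (Suc n))\<^sup>2 \<le> (2 * real n + 1) * (cb n)\<^sup>2"
    by (simp add: algebra_simps)
qed

text \<open>The partial products of Wallis' product are the reciprocals of these terms.\<close>

lemma cb_sq_limit: "(\<lambda>n. (2 * real n + 1) * (cb n)\<^sup>2) \<longlonglongrightarrow> 2 / pi"
proof -
  have "(\<Prod>k=1..n. (4*real k^2) / (4*real k^2 - 1)) = inverse ((2 * real n + 1) * (cb n)\<^sup>2)" for n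
  proof (induction n)
    case (Suc n)
    have step: "inverse (a * c\<^sup>2) * (b\<^sup>2 / (a * d)) = inverse (d * (c * a / b)\<^sup>2)"
      if "a > 0" "b > 0" "c > 0" "d > 0" for a b c d :: real
      using that by (simp add: divide_simps power2_eq_square)
    have "4 * (real (Suc n))\<^sup>2 - 1 = (2 * real n + 1) * (2 * real n + 3)"
      "4 * (real (Suc n))\<^sup>2 = (2 * real n + 2)\<^sup>2" "2 * real (Suc n) + 1 = 2 * real n + 3"
      by (simp_all add: algebra_simps power2_eq_square)
    then show ?case
      using Suc step[of "2 * real n + 1" "2 * real n + 2" "cb n" "2 * real n + 3"]
      by (simp add: cb_Suc del: of_nat_Suc)
  qed auto
  then have "(\<lambda>n. inverse ((2 * real n + 1) * (cb n)\<^sup>2)) \<longlonglongrightarrow> pi / 2"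
    using wallis by simp
  from tendsto_inverse[OF this] show ?thesis by simp
qed

lemma cb_sq_lower: "2 / pi \<le> (2 * real n + 1) * (cb n)\<^sup>2"
  using decseq_ge[OF cb_sq_antimono cb_sq_limit] .

lemma cb_sq_upper: "real n * (cb n)\<^sup>2 \<le> 1 / pi"
proof (rule incseq_le[OF cb_sq_mono])
  have "(\<lambda>n. (2 * real n + 1) * (cb n)\<^sup>2 * (real n / (2 * real n + 1))) \<longlonglongrightarrow> 2 / pi * (1 / 2)"
    by (intro tendsto_mult cb_sq_limit) real_asymp
  moreover have "(2 * real n + 1) * (cb n)\<^sup>2 * (real n / (2 * real n + 1)) = real n * (cb n)\<^sup>2" for n
  proof -
    have "2 * real n + 1 \<noteq> 0" by linarith
    then show ?thesis by simp
  qed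
  ultimately show "(\<lambda>n. real n * (cb n)\<^sup>2) \<longlonglongrightarrow> 1 / pi"
    by (simp add: mult.commute)
qed

lemma cb_upper:
  assumes "n > 0"
  shows "cb n \<le> 1 / sqrt (pi * real n)"
proof -
  have "(cb n)\<^sup>2 \<le> 1 / (pi * real n)"
    using cb_sq_upper[of n] assms by (simp add: pos_le_divide_eq mult_ac)
  then show ?thesis
    using real_le_rsqrt by (fastforce simp: real_sqrt_divide)
qed

lemma cb_lower: "1 / sqrt (pi * (real n + 1 / 2)) \<le> cb n"
proof -
  have "1 / (pi * (real n + 1 / 2)) \<le> (cb n)\<^sup>2"
    using cb_sq_lower[of n]
    by (subst pos_divide_le_eq) (simp_all add: pos_divide_le_eq algebra_simps add_nonneg_pos)
  then have "sqrt (1 / (pi * (real n + 1 / 2))) \<le> cb n"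
    by (intro real_le_lsqrt) (simp_all add: less_imp_le)
  then show ?thesis
    by (simp add: real_sqrt_divide)
qed

lemma decseq_cb: "decseq cb"
  by (rule decseq_SucI) (simp add: cb_Suc field_simps less_imp_le)

text \<open>Monotonicity of \<open>n (cb n)^2\<close> bounds the squared quotient by
  \<open>n / (n - k)\<close>, which is at most \<open>1 + 2k/n\<close> when \<open>2k <= n\<close>.
  It shows that removing a small subtree hardly changes the normalised counts.\<close>

lemma cb_ratio:
  assumes "2 * k \<le> n" "n > 0"
  shows "cb (n - k) \<le> (1 + 2 * real k / real n) * cb n" and "cb n \<le> cb (n - k)"
proof -
  have nk: "real (n - k) > 0" "real (n - k) = real n - real k"
    using assms by auto
  have "real (n - k) * (cb (n - k))\<^sup>2 \<le> real n * (cb n)\<^sup>2"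
    using incseqD[OF cb_sq_mono, of "n - k" n] by simp
  also have "real n \<le> real (n - k) * (1 + 2 * real k / real n)"
  proof -
    have "real k * (2 * real k) \<le> real k * real n"
      using assms by (intro mult_left_mono) auto
    then show ?thesis using assms nk by (simp add: field_simps)
  qed
  then have "real n * (cb n)\<^sup>2 \<le> real (n - k) * (1 + 2 * real k / real n) * (cb n)\<^sup>2"
    by (rule mult_right_mono) simp
  finally have "(cb (n - k))\<^sup>2 \<le> (1 + 2 * real k / real n) * (cb n)\<^sup>2"
    using nk by (simp add: mult.assoc)
  also have "\<dots> \<le> (1 + 2 * real k / real n)\<^sup>2 * (cb n)\<^sup>2"
    by (intro mult_right_mono self_le_power) auto
  finally have "(cb (n - k))\<^sup>2 \<le> ((1 + 2 * real k / real n) * cb n)\<^sup>2"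
    by (simp add: power_mult_distrib)
  then show "cb (n - k) \<le> (1 + 2 * real k / real n) * cb n"
    by (rule power2_le_imp_le) (simp add: less_imp_le)
  show "cb n \<le> cb (n - k)"
    using decseqD[OF decseq_cb] by simp
qed

text \<open>Consecutive terms have quotient \<open>(2n + 3) / (2n + 2)\<close>. These are the
  normalised coefficients that count pairs of occurrences.\<close>

lemma cb_mult_mono: "incseq (\<lambda>n. (2 * real n + 1) * cb n)"
proof (rule incseq_SucI)
  fix n
  have "(2 * real n + 1) * cb n * (2 * real n + 2) \<le> (2 * real n + 1) * cb n * (2 * real n + 3)"
    by (intro mult_left_mono) (auto intro: less_imp_le)
  then show "(2 * real n + 1) * cb n \<le> (2 * real (Suc n) + 1) * cb (Suc n)"
    by (simp add: cb_Suc field_simps)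
qed

text \<open>Since \<open>L <= K + j\<close>, the upper bound is immediate. For the lower one,
  \<open>K + j + 1/2 <= L + 5/2\<close>, and the relative loss \<open>5 / (4L)\<close> is half of
  \<open>5 / (2L)\<close> by linearising the root.\<close>

lemma cb_approx:
  assumes "real K \<le> L" "L \<le> real K + 1" "L > 0" "1 \<le> j" "j \<le> 2"
  shows "\<bar>cb (K + j) - 1 / sqrt (pi * L)\<bar> \<le> 5 / (4 * (L * sqrt L))"
proof -
  have "cb (K + j) \<le> 1 / sqrt (pi * real (K + j))"
    using assms by (intro cb_upper) auto
  also have "\<dots> \<le> 1 / sqrt (pi * L)"
    using assms by (intro divide_left_mono real_sqrt_le_mono mult_left_mono) auto
  finally have upper: "cb (K + j) \<le> 1 / sqrt (pi * L)" .
  have "1 / sqrt (pi * L) - 5 / (4 * (L * sqrt L)) \<le> 1 / sqrt (pi * L) * (1 - 5 / (4 * L))"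
  proof -
    have "sqrt 1 * sqrt L \<le> sqrt pi * sqrt L"
      using assms pi_ge_two by (intro mult_right_mono real_sqrt_le_mono) auto
    then have "5 / (4 * L) * (1 / sqrt (pi * L)) \<le> 5 / (4 * L) * (1 / sqrt L)"
      using assms by (intro mult_left_mono divide_left_mono) (auto simp: real_sqrt_mult)
    then show ?thesis by (simp add: right_diff_distrib mult_ac)
  qed
  also have "\<dots> \<le> 1 / sqrt (pi * L) * (1 / sqrt (1 + 5 / (2 * L)))"
  proof (rule mult_left_mono)
    define x where "x = 5 / (4 * L)"
    have x: "x > 0" using assms by (simp add: x_def)
    have "sqrt (1 + 2 * x) \<le> 1 + x"
      using x by (intro real_le_lsqrt) (auto simp: power2_eq_square algebra_simps)
    then have "1 / (1 + x) \<le> 1 / sqrt (1 + 2 * x)"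
      using x by (intro divide_left_mono) auto
    moreover have "1 - x \<le> 1 / (1 + x)"
      using x by (simp add: field_simps)
    moreover have "2 * x = 5 / (2 * L)" by (simp add: x_def)
    ultimately show "1 - 5 / (4 * L) \<le> 1 / sqrt (1 + 5 / (2 * L))"
      by (simp add: x_def)
  qed (use assms in auto)
  also have "\<dots> = 1 / sqrt (pi * (L + 5 / 2))"
  proof -
    have "pi * (L + 5 / 2) = pi * L * (1 + 5 / (2 * L))"
      using assms by (simp add: field_simps)
    then show ?thesis by (simp only: real_sqrt_mult) simp
  qed
  also have "\<dots> \<le> 1 / sqrt (pi * (real (K + j) + 1 / 2))"
    using assms by (intro divide_left_mono real_sqrt_le_mono mult_left_mono) (auto intro!: mult_pos_pos)
  also have "\<dots> \<le> cb (K + j)" by (rule cb_lower)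
  finally show ?thesis using upper by linarith
qed

text \<open>Each term equals \<open>2 (cb k - cb (k + 1))\<close>, so the sum telescopes.\<close>

lemma sum_cb_div: "(\<Sum>k\<le>n. cb k / (real k + 1)) = 2 - 2 * cb (Suc n)"
proof (induction n)
  case (Suc n)
  have "cb (Suc n) = 2 * cb (Suc n) * (real n + 2) - 2 * cb (Suc (Suc n)) * (real n + 2)"
    unfolding cb_Suc[of "Suc n"] by (simp add: field_simps)
  then have "cb (Suc n) / (real (Suc n) + 1) = 2 * cb (Suc n) - 2 * cb (Suc (Suc n))"
    by (simp add: field_simps)
  then show ?case using Suc by simp
qed (simp add: cb_Suc)

section \<open>Coefficient extraction\<close>

text \<open>\<open>S\<close> is the square root of \<open>1 - 4mX\<close>, the discriminant of the
  quadratic equation for \<open>T\<close>. Its inverse \<open>B\<close> satisfies a first-order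
  linear differential equation, which yields the recurrence of the central binomial
  coefficients.\<close>

lemma fps_quadratic:
  fixes T :: "real fps"
  assumes T: "T = fps_const (real m) + fps_X * (T * T)" and "m > 0"
  defines "S \<equiv> 1 - 2 * fps_X * T" and "q \<equiv> 4 * real m"
  shows "S * S = 1 - fps_const q * fps_X"
    and "S * inverse S = 1"
    and "inverse S $ n = q ^ n * cb n"
    and "(inverse S ^ 3) $ n = q ^ n * ((2 * real n + 1) * cb n)"
    and "T $ n = real m * q ^ n * cb n / (real n + 1)"
proof -
  define B where "B = inverse S"
  have "S * S = 1 - 4 * fps_X * (T - fps_X * (T * T))"
    by (simp add: S_def algebra_simps)
  also have "T - fps_X * (T * T) = fps_const (real m)"
    by (subst (1) T) simp
  also have "1 - 4 * fps_X * fps_const (real m) = 1 - fps_const q * fps_X"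
    by (simp add: q_def numeral_fps_const flip: fps_const_mult)
  finally show SS: "S * S = 1 - fps_const q * fps_X" .
  have "S $ 0 = 1" by (simp add: S_def mult.assoc)
  then show SB: "S * inverse S = 1"
    using inverse_mult_eq_1'[of S] by simp
  then have SB': "S * B = 1" by (simp add: B_def)
  have "B * B * (S * S) = (S * B) * (S * B)"
    by (simp add: mult_ac)
  then have BB: "B * B * (1 - fps_const q * fps_X) = 1"
    by (simp add: SS SB')
  \<comment> \<open>Differentiate \<open>B^2 (1 - qX) = 1\<close>; multiplying by \<open>S\<close>
    afterwards cancels one factor \<open>B\<close>.\<close>
  have "2 * B * (fps_deriv B * (1 - fps_const q * fps_X)) - B * B * fps_const q =
      fps_deriv (B * B * (1 - fps_const q * fps_X))"
    by (simp add: algebra_simps)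
  then have "2 * B * (fps_deriv B * (1 - fps_const q * fps_X)) = B * B * fps_const q"
    by (simp add: BB)
  then have "S * (2 * B * (fps_deriv B * (1 - fps_const q * fps_X))) = S * (B * B * fps_const q)"
    by simp
  then have "2 * (S * B) * (fps_deriv B * (1 - fps_const q * fps_X)) = (S * B) * B * fps_const q"
    by (simp only: mult_ac)
  then have dB: "2 * (fps_deriv B * (1 - fps_const q * fps_X)) = B * fps_const q"
    by (simp add: SB')
  have rec: "2 * (real n + 1) * B $ Suc n = q * (2 * real n + 1) * B $ n" for n
  proof -
    have "2 * (fps_deriv B * (1 - fps_const q * fps_X)) =
        fps_const 2 * (fps_deriv B - fps_const q * (fps_X * fps_deriv B))"
      by (simp add: algebra_simps numeral_fps_const)
    then have "(fps_const 2 * (fps_deriv B - fps_const q * (fps_X * fps_deriv B))) $ n = (fps_const q * B) $ n"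
      using dB by (simp add: mult.commute)
    then show ?thesis
      by (cases n) (simp_all add: algebra_simps)
  qed
  have Bn: "B $ n = q ^ n * cb n" for n
  proof (induction n)
    case 0
    show ?case using \<open>S $ 0 = 1\<close> by (simp add: B_def)
  next
    case (Suc n)
    have "2 * (real n + 1) * B $ Suc n = 2 * (real n + 1) * (q ^ Suc n * cb (Suc n))"
      unfolding rec Suc cb_Suc by (simp add: field_simps)
    then show ?case by simp
  qed
  then show "inverse S $ n = q ^ n * cb n" by (simp add: B_def)
  \<comment> \<open>Multiplied by \<open>B^2\<close>, the differential equation becomes
    \<open>2 B' = q B^3\<close>, so the cube is read off from the derivative.\<close>
  have "B * B * (2 * (fps_deriv B * (1 - fps_const q * fps_X))) = B * B * (B * fps_const q)"
    by (simp add: dB)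
  then have "2 * fps_deriv B * (B * B * (1 - fps_const q * fps_X)) = fps_const q * B ^ 3"
    by (simp only: mult_ac power3_eq_cube)
  then have "(fps_const 2 * fps_deriv B) $ n = (fps_const q * B ^ 3) $ n"
    by (simp add: BB numeral_fps_const)
  then have "2 * ((real n + 1) * B $ Suc n) = q * (B ^ 3) $ n"
    by (simp add: add.commute)
  then have "q * (B ^ 3) $ n = q * (q ^ n * ((2 * real n + 1) * cb n))"
    using rec[of n] Bn[of n] by (simp add: algebra_simps)
  then show "(inverse S ^ 3) $ n = q ^ n * ((2 * real n + 1) * cb n)"
    using \<open>m > 0\<close> by (simp add: B_def q_def)
  \<comment> \<open>Writing \<open>S\<close> as \<open>(1 - qX) B\<close> expresses
    \<open>2XT = 1 - S\<close> through the known coefficients of \<open>B\<close>.\<close>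
  have "S = S * (S * B)" by (simp add: SB')
  also have "\<dots> = (S * S) * B" by (simp add: mult.assoc)
  finally have "S = (1 - fps_const q * fps_X) * B"
    by (simp only: SS)
  moreover have "fps_const 2 * (fps_X * T) = 1 - S"
    by (simp add: S_def mult.assoc numeral_fps_const)
  moreover have "1 - (1 - fps_const q * fps_X) * B = 1 - B + fps_const q * (fps_X * B)"
    by (simp add: algebra_simps)
  ultimately have "(fps_const 2 * (fps_X * T)) $ Suc n = (1 - B + fps_const q * (fps_X * B)) $ Suc n"
    by simp
  then have "2 * T $ n = q * B $ n - B $ Suc n"
    by simp
  also have "\<dots> = 2 * (real m * q ^ n * cb n / (real n + 1))"
    by (simp add: Bn cb_Suc field_simps) (simp add: q_def algebra_simps)
  finally show "T $ n = real m * q ^ n * cb n / (real n + 1)"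
    by simp
qed

lemma card_trees_of_size:
  assumes "m > 0"
  shows "real (card (trees_of_size m n)) = real m * (4 * real m) ^ n * cb n / (real n + 1)"
  using fps_quadratic(5)[OF tree_gf_one assms, of n] by (simp add: tree_gf_nth)

text \<open>From \<open>D (1 - XT) = X T^2\<close> and \<open>T (1 - XT) = m\<close> follows
  \<open>m D = T^2 - m T\<close>, and the coefficients of \<open>T^2\<close> are those of
  \<open>T\<close> shifted by one.\<close>

lemma sum_degrees:
  assumes "m > 0"
  shows "(\<Sum>t\<in>trees_of_size m n. real (length (children t))) =
    real (card (trees_of_size m (Suc n))) / real m - real (card (trees_of_size m n))"
proof -
  define T D where "T = tree_gf m (\<lambda>_. 1)" and "D = tree_gf m (\<lambda>t. real (length (children t)))"
  have T: "T = fps_const (real m) + fps_X * (T * T)"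
    unfolding T_def by (rule tree_gf_one)
  have D: "D = fps_X * (T * T + T * D)"
    unfolding T_def D_def by (rule tree_gf_degree)
  have "fps_const (real m) * D = T * D - fps_X * (T * T) * D"
    using T by (metis add_diff_cancel_right' left_diff_distrib)
  also have "\<dots> = T * (D - fps_X * T * D)"
    by (simp add: algebra_simps)
  also have "D - fps_X * T * D = fps_X * (T * T)"
    by (subst (1) D) (simp add: algebra_simps)
  also have "\<dots> = T - fps_const (real m)"
    by (subst (3) T) simp
  finally have mD: "fps_const (real m) * D = T * T - fps_const (real m) * T"
    by (simp add: algebra_simps)
  have "(T * T) $ n = T $ Suc n"
    by (subst (3) T) simp
  moreover have "real m * D $ n = (T * T) $ n - real m * T $ n"
    using arg_cong[OF mD, of "\<lambda>f. f $ n"] by simp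
  ultimately have "D $ n = T $ Suc n / real m - T $ n"
    using assms by (simp add: field_simps)
  then show ?thesis
    by (simp add: T_def D_def tree_gf_nth)
qed

text \<open>Both linear equations are solved by multiplying with \<open>B\<close>: occurrences have
  generating function \<open>X^k (B + 1) / 2\<close>, ordered pairs \<open>2m X^(2k+2) B^3\<close>.
  The condition \<open>k < n\<close> avoids the extra monomial at \<open>n = k\<close>.\<close>

lemma sum_occ:
  assumes "m > 0" "s \<in> trees_of_size m k"
  shows "k < n \<Longrightarrow> (\<Sum>t\<in>trees_of_size m n. occ s t) = (4 * real m) ^ (n - k) * cb (n - k) / 2"
    and "(\<Sum>t\<in>trees_of_size m n. occ s t * (occ s t - 1)) =
      (if n < 2 * k + 2 then 0
       else 2 * real m * (4 * real m) ^ (n - (2 * k + 2)) *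
         ((2 * real (n - (2 * k + 2)) + 1) * cb (n - (2 * k + 2))))"
proof -
  define T I P B where "T = tree_gf m (\<lambda>_. 1)" and "I = tree_gf m (inner_occ s)"
    and "P = tree_gf m (\<lambda>t. occ s t * (occ s t - 1))" and "B = inverse (1 - 2 * fps_X * T)"
  have T: "T = fps_const (real m) + fps_X * (T * T)"
    unfolding T_def by (rule tree_gf_one)
  note q = fps_quadratic[OF T assms(1), folded B_def]
  have O: "tree_gf m (occ s) = I + fps_X ^ k"
    unfolding I_def by (rule tree_gf_occ) fact
  have I: "I = fps_X * ((I + fps_X ^ k) * T + T * I)"
    unfolding T_def I_def by (simp flip: tree_gf_occ[OF assms(2)] add: tree_gf_inner_occ[symmetric])
  have P: "P = fps_X * (P * T + T * P + 2 * ((I + fps_X ^ k) * I))"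
    unfolding T_def P_def O[symmetric] unfolding I_def by (rule tree_gf_pairs)
  have "I - 2 * fps_X * T * I = fps_X ^ k * (fps_X * T)"
    by (subst (1) I) (simp add: algebra_simps)
  then have "I * (1 - 2 * fps_X * T) = fps_X ^ k * (fps_X * T)"
    by (simp add: algebra_simps)
  then have "I * ((1 - 2 * fps_X * T) * B) = fps_X ^ k * (fps_X * T * B)"
    by (simp only: mult.assoc[symmetric])
  then have I': "I = fps_X ^ k * (fps_X * T * B)"
    by (simp add: q)
  have XTB: "2 * (fps_X * T * B) = B - 1"
    using q(2) by (simp add: algebra_simps)
  have "2 * I = fps_X ^ k * (B - 1)"
    unfolding I' XTB[symmetric] by (simp only: mult_ac)
  then have "2 * tree_gf m (occ s) = fps_X ^ k * (B + 1)"
    by (simp add: O algebra_simps)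
  then have "fps_const 2 * tree_gf m (occ s) = fps_X ^ k * (B + 1)"
    by (simp add: numeral_fps_const)
  then have "(fps_const 2 * tree_gf m (occ s)) $ n = (fps_X ^ k * (B + 1)) $ n"
    by simp
  then show "(\<Sum>t\<in>trees_of_size m n. occ s t) = (4 * real m) ^ (n - k) * cb (n - k) / 2" if "k < n"
    using that by (simp add: fps_X_power_mult_nth tree_gf_nth q(3))
  have "P - 2 * fps_X * T * P = 2 * fps_X * ((I + fps_X ^ k) * I)"
    by (subst (1) P) (simp add: algebra_simps)
  then have "P * (1 - 2 * fps_X * T) = 2 * fps_X * ((I + fps_X ^ k) * I)"
    by (simp add: algebra_simps)
  then have "P * ((1 - 2 * fps_X * T) * B) = 2 * fps_X * ((I + fps_X ^ k) * I) * B"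
    by (simp only: mult.assoc[symmetric])
  then have "P = 2 * fps_X * ((I + fps_X ^ k) * I) * B"
    by (simp add: q)
  \<comment> \<open>In this form the product with \<open>I\<close> contains
    \<open>T (1 - XT)\<close>, which collapses to the constant \<open>m\<close>.\<close>
  also have "I + fps_X ^ k = fps_X ^ k * ((1 - fps_X * T) * B)"
  proof -
    have "(1 - 2 * fps_X * T) * B = 1" by (rule q(2))
    then have "fps_X * T * B + 1 = (1 - fps_X * T) * B"
      by (simp add: algebra_simps)
    moreover have "I + fps_X ^ k = fps_X ^ k * (fps_X * T * B + 1)"
      by (subst I') (simp add: distrib_left)
    ultimately show ?thesis by simp
  qed
  also have "2 * fps_X * ((fps_X ^ k * ((1 - fps_X * T) * B)) * I) * B =
      2 * fps_X ^ (2 * k + 2) * (T - fps_X * (T * T)) * B ^ 3"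
  proof -
    have "2 * x * ((y * ((1 - x * T) * B)) * (y * (x * T * B))) * B =
        2 * (y * y * (x * x)) * (T - x * (T * T)) * B ^ 3" for x y :: "real fps"
      by (simp add: algebra_simps power3_eq_cube)
    moreover have "fps_X ^ (2 * k + 2) = fps_X ^ k * fps_X ^ k * (fps_X * fps_X :: real fps)"
      by (simp only: power_add mult_2 power2_eq_square)
    ultimately show ?thesis
      by (simp only: I')
  qed
  also have "T - fps_X * (T * T) = fps_const (real m)"
    by (subst (1) T) simp
  finally have "P = fps_const (2 * real m) * (fps_X ^ (2 * k + 2) * B ^ 3)"
    by (simp add: numeral_fps_const mult_ac flip: fps_const_mult)
  then have "P $ n = (fps_const (2 * real m) * (fps_X ^ (2 * k + 2) * B ^ 3)) $ n"
    by simp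
  then show "(\<Sum>t\<in>trees_of_size m n. occ s t * (occ s t - 1)) =
      (if n < 2 * k + 2 then 0
       else 2 * real m * (4 * real m) ^ (n - (2 * k + 2)) *
         ((2 * real (n - (2 * k + 2)) + 1) * cb (n - (2 * k + 2))))"
    by (simp add: P_def tree_gf_nth fps_X_power_mult_nth q(4) del: power_Suc)
qed

section \<open>The average number of edges\<close>

definition degree_sum :: "nat \<Rightarrow> nat \<Rightarrow> real" where
  "degree_sum m k = (\<Sum>s\<in>trees_of_size m k. real (length (children s)))"

lemma degree_sum_nonneg: "degree_sum m k \<ge> 0"
  unfolding degree_sum_def by (intro sum_nonneg) auto

lemma sum_trees_upto:
  fixes f :: "utree \<Rightarrow> real"
  shows "(\<Sum>s\<in>(\<Union>k\<le>n. trees_of_size m k). f s) = (\<Sum>k\<le>n. \<Sum>s\<in>trees_of_size m k. f s)"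
  by (rule sum.UNION_disjoint) (auto, auto simp: trees_of_size_def)

text \<open>Exchange of summation: each \<open>s\<close> contributes its root degree once for every
  tree containing it.\<close>

lemma sum_dag_edges:
  "(\<Sum>t\<in>trees_of_size m n. real (dag_edges t)) =
    (\<Sum>k\<le>n. \<Sum>s\<in>trees_of_size m k. real (length (children s)) *
      (\<Sum>t\<in>trees_of_size m n. of_bool (s \<in> subtrees t)))"
proof -
  have "real (dag_edges t) =
      (\<Sum>k\<le>n. \<Sum>s\<in>trees_of_size m k. real (length (children s)) * of_bool (s \<in> subtrees t))"
    if "t \<in> trees_of_size m n" for t
  proof -
    have "real (dag_edges t) = (\<Sum>s\<in>(\<Union>k\<le>n. trees_of_size m k).
        real (length (children s)) * of_bool (s \<in> subtrees t))"
      unfolding dag_edges_def of_nat_sum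
      using subtrees_in_trees[OF that] by (intro sum.mono_neutral_cong_left) auto
    then show ?thesis unfolding sum_trees_upto .
  qed
  then have "(\<Sum>t\<in>trees_of_size m n. real (dag_edges t)) = (\<Sum>t\<in>trees_of_size m n.
      \<Sum>k\<le>n. \<Sum>s\<in>trees_of_size m k. real (length (children s)) * of_bool (s \<in> subtrees t))"
    by simp
  also have "\<dots> = (\<Sum>k\<le>n. \<Sum>s\<in>trees_of_size m k. \<Sum>t\<in>trees_of_size m n.
      real (length (children s)) * of_bool (s \<in> subtrees t))"
    by (subst sum.swap, rule sum.cong[OF refl], rule sum.swap)
  finally show ?thesis
    by (simp only: sum_distrib_left)
qed

text \<open>With multiplicity, every single tree of size \<open>n\<close> contributes exactly its
  \<open>n\<close> edges.\<close>

lemma sum_occ_degrees: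
  "(\<Sum>k\<le>n. \<Sum>s\<in>trees_of_size m k. real (length (children s)) * (\<Sum>t\<in>trees_of_size m n. occ s t)) =
    real n * real (card (trees_of_size m n))"
proof -
  have "(\<Sum>k\<le>n. \<Sum>s\<in>trees_of_size m k. real (length (children s)) * occ s t) = real n"
    if "t \<in> trees_of_size m n" for t
  proof -
    have "real n = real (sum_list (map (\<lambda>s. length (children s)) (nodes t)))"
      using that by (simp add: sum_list_degrees trees_of_size_def)
    also have "\<dots> = (\<Sum>s\<in>(\<Union>k\<le>n. trees_of_size m k). real (length (children s)) * occ s t)"
      using subtrees_in_trees[OF that]
      by (subst sum_list_map_eq_sum_count2[of _ "\<Union>k\<le>n. trees_of_size m k"])
        (auto simp: set_nodes occ_def mult.commute)
    finally show ?thesis unfolding sum_trees_upto by simp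
  qed
  then have "real n * real (card (trees_of_size m n)) = (\<Sum>t\<in>trees_of_size m n.
      \<Sum>k\<le>n. \<Sum>s\<in>trees_of_size m k. real (length (children s)) * occ s t)"
    by (simp add: mult.commute)
  also have "\<dots> = (\<Sum>k\<le>n. \<Sum>s\<in>trees_of_size m k. \<Sum>t\<in>trees_of_size m n.
      real (length (children s)) * occ s t)"
    by (subst sum.swap, rule sum.cong[OF refl], rule sum.swap)
  finally show ?thesis
    by (simp only: sum_distrib_left)
qed

text \<open>Bonferroni for a count \<open>c\<close>: the lower bound for \<open>c > 0\<close> is
  \<open>(c - 1)^2 >= 0\<close>.\<close>

lemma occ_bounds:
  "of_bool (s \<in> subtrees t) \<le> occ s t"
  "occ s t - occ s t * (occ s t - 1) \<le> of_bool (s \<in> subtrees t)"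
proof -
  define c where "c = count_list (nodes t) s"
  have c: "occ s t = real c" "s \<in> subtrees t \<longleftrightarrow> c \<noteq> 0"
    by (auto simp: c_def occ_def count_list_0_iff set_nodes)
  have "real c - real c * (real c - 1) \<le> of_bool (c \<noteq> 0)"
  proof (cases "c = 0")
    case False
    then have "(real c - 1)\<^sup>2 \<ge> 0" by simp
    then have "real c - real c * (real c - 1) \<le> 1" by (simp add: algebra_simps power2_eq_square)
    then show ?thesis using False by simp
  qed auto
  then show "of_bool (s \<in> subtrees t) \<le> occ s t"
    "occ s t - occ s t * (occ s t - 1) \<le> of_bool (s \<in> subtrees t)"
    using c by auto
qed

lemma sum_atMost_split:
  fixes f :: "nat \<Rightarrow> real"
  assumes "K \<le> n"
  shows "(\<Sum>k\<le>n. f k) = (\<Sum>k\<le>K. f k) + (\<Sum>k\<in>{Suc K..n}. f k)"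
proof -
  have "{..n} = {..K} \<union> {Suc K..n}" using assms by auto
  then show ?thesis by (simp add: sum.union_disjoint)
qed

section \<open>Expected occurrences and pairs for a fixed size\<close>

locale dag_average =
  fixes m n :: nat
  assumes m: "m > 0" and n: "n > 0"
begin

definition "q = 4 * real m"
definition "N = real (card (trees_of_size m n))"

lemma q_ge: "q \<ge> 4" using m by (simp add: q_def)

lemma N_eq: "N = real m * q ^ n * cb n / (real n + 1)"
  unfolding N_def q_def by (rule card_trees_of_size[OF m])

lemma N_pos: "N > 0"
  using m by (simp add: N_eq q_def)

lemma occ_ratio:
  assumes "s \<in> trees_of_size m k" "k < n"
  shows "(\<Sum>t\<in>trees_of_size m n. occ s t) / N = (real n + 1) / (2 * real m * q ^ k) * (cb (n - k) / cb n)"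
proof -
  have qn: "q ^ n = q ^ (n - k) * q ^ k"
    using assms by (simp flip: power_add)
  have "(a * c' / 2) / (M * (a * b) * c / (x + 1)) = (x + 1) / (2 * M * b) * (c' / c)"
    if "a > 0" "b > 0" "c > 0" "M > 0" for a b c c' M x :: real
    using that by (simp add: divide_simps)
  moreover have "(\<Sum>t\<in>trees_of_size m n. occ s t) / N =
      (q ^ (n - k) * cb (n - k) / 2) / (real m * (q ^ (n - k) * q ^ k) * cb n / (real n + 1))"
    unfolding N_eq qn sum_occ(1)[OF m assms] by (simp only: q_def)
  ultimately show ?thesis
    using m q_ge by (simp add: mult_ac)
qed

text \<open>If \<open>n < 2k + 2\<close>, two disjoint copies of \<open>s\<close> with their parent
  edges do not fit. Otherwise monotonicity raises the index \<open>n - (2k + 2)\<close> to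
  \<open>n\<close>, and \<open>cb n\<close> cancels.\<close>

lemma pairs_ratio:
  assumes "s \<in> trees_of_size m k"
  shows "(\<Sum>t\<in>trees_of_size m n. occ s t * (occ s t - 1)) / N \<le>
    2 * (2 * real n + 1) * (real n + 1) / q ^ (2 * k + 2)"
proof (cases "n < 2 * k + 2")
  case True
  then show ?thesis
    using q_ge by (simp add: sum_occ(2)[OF m assms])
next
  case False
  define i where "i = n - (2 * k + 2)"
  have qn: "q ^ n = q ^ i * q ^ (2 * k + 2)"
  proof -
    have "n = i + (2 * k + 2)" using False by (simp add: i_def)
    then show ?thesis by (metis power_add)
  qed
  have pos: "cb n > 0" "q > 0" "real m > 0" using q_ge m by auto
  have "(2 * real i + 1) * cb i \<le> (2 * real n + 1) * cb n"
    using incseqD[OF cb_mult_mono, of i n] by (simp add: i_def)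
  then have "2 * real m * q ^ i * ((2 * real i + 1) * cb i) \<le> 2 * real m * q ^ i * ((2 * real n + 1) * cb n)"
    using pos by (intro mult_left_mono) auto
  then have "(\<Sum>t\<in>trees_of_size m n. occ s t * (occ s t - 1)) / N \<le>
      2 * real m * q ^ i * ((2 * real n + 1) * cb n) / N"
    using False N_pos sum_occ(2)[OF m assms, of n]
    by (intro divide_right_mono) (simp_all add: i_def q_def del: power_Suc)
  also have "\<dots> = 2 * (2 * real n + 1) * (real n + 1) / q ^ (2 * k + 2)"
  proof -
    have "2 * M * a * ((2 * x + 1) * c) / (M * (a * b) * c / (x + 1)) = 2 * (2 * x + 1) * (x + 1) / b"
      if "a > 0" "b > 0" "c > 0" "M > 0" for a b c M x :: real
      using that by (simp add: divide_simps)
    then show ?thesis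
      using pos unfolding N_eq qn by (simp del: power_Suc)
  qed
  finally show ?thesis .
qed

section \<open>Total root degrees by size and the two error sums\<close>

lemma degree_sum_eq:
  "degree_sum m k / (real m * q ^ k) = 4 * (cb (Suc k) / (real (Suc k) + 1)) - cb k / (real k + 1)"
proof -
  have "degree_sum m k = (real m * q ^ Suc k * cb (Suc k) / (real (Suc k) + 1)) / real m -
      real m * q ^ k * cb k / (real k + 1)"
    unfolding degree_sum_def sum_degrees[OF m] card_trees_of_size[OF m] q_def by simp
  also have "\<dots> = (real m * q ^ k) * (4 * (cb (Suc k) / (real (Suc k) + 1)) - cb k / (real k + 1))"
    using m by (simp add: right_diff_distrib) (simp add: q_def)
  finally show ?thesis
    using m by (simp add: q_def del: of_nat_Suc)
qed

lemma degree_sum_le: "degree_sum m k \<le> q ^ Suc k / (real (Suc k) * sqrt (real (Suc k)))"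
proof -
  have "degree_sum m k \<le> real (card (trees_of_size m (Suc k))) / real m"
    unfolding degree_sum_def sum_degrees[OF m] by simp
  also have "\<dots> = q ^ Suc k * (cb (Suc k) / (real (Suc k) + 1))"
    unfolding card_trees_of_size[OF m] q_def using m by simp
  also have "\<dots> \<le> q ^ Suc k * (1 / sqrt (real (Suc k)) / real (Suc k))"
  proof (intro mult_left_mono frac_le)
    have "1 * real (Suc k) \<le> pi * real (Suc k)"
      using pi_ge_two by (intro mult_right_mono) auto
    then have "1 / sqrt (pi * real (Suc k)) \<le> 1 / sqrt (real (Suc k))"
      by (intro divide_left_mono) auto
    then show "cb (Suc k) \<le> 1 / sqrt (real (Suc k))"
      using cb_upper[of "Suc k"] by linarith
  qed (use q_ge in auto)
  finally show ?thesis by (simp add: mult.commute)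
qed

text \<open>The bounds on the summands grow by a factor of at least 4/3, so four times the last one
  dominates the sum.\<close>

lemma sum_degree_sum_le: "(\<Sum>k\<le>K. degree_sum m k) \<le> 4 * (q ^ Suc K / (real (Suc K) * sqrt (real (Suc K))))"
proof (induction K)
  case 0
  then show ?case using degree_sum_le[of 0] q_ge by simp
next
  case (Suc K)
  define x where "x = real (Suc K)"
  have x: "x \<ge> 1" by (simp add: x_def)
  \<comment> \<open>For \<open>x >= 1\<close> the factor \<open>(1 + 1/x)^(3/2)\<close> is at most
    \<open>2 sqrt 2 <= 3\<close>, while \<open>q >= 4\<close>.\<close>
  have "4 * (q ^ Suc K / (x * sqrt x)) \<le> 3 * (q ^ Suc (Suc K) / ((x + 1) * sqrt (x + 1)))"
  proof -
    have "sqrt (x + 1) \<le> sqrt (2 * x)" using x by simp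
    also have "\<dots> = sqrt 2 * sqrt x" by (rule real_sqrt_mult)
    also have "\<dots> \<le> 3 / 2 * sqrt x" by (intro mult_right_mono real_le_lsqrt) (use x in \<open>auto simp: power2_eq_square\<close>)
    finally have "(x + 1) * sqrt (x + 1) \<le> (2 * x) * (3 / 2 * sqrt x)"
      using x by (intro mult_mono) auto
    moreover have "4 * (x * sqrt x) \<le> q * (x * sqrt x)"
      using x q_ge by (intro mult_right_mono) auto
    ultimately have "4 * ((x + 1) * sqrt (x + 1)) \<le> 3 * (q * (x * sqrt x))"
      by linarith
    then have "q ^ Suc K * (4 * ((x + 1) * sqrt (x + 1))) \<le> q ^ Suc K * (3 * (q * (x * sqrt x)))"
      using q_ge by (intro mult_left_mono) auto
    then show ?thesis using x by (simp add: divide_simps mult_ac)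
  qed
  moreover have x1: "real (Suc (Suc K)) = x + 1" by (simp add: x_def)
  ultimately show ?case
    using Suc[folded x_def] degree_sum_le[of "Suc K"] unfolding x1 sum.atMost_Suc by linarith
qed

text \<open>The subtracted term is what carries the induction; the step uses
  \<open>q >= 2\<close>.\<close>

lemma sum_inverse_powers: "(\<Sum>k\<in>{Suc K..K + j}. 1 / q ^ Suc k) \<le> 1 / q ^ Suc K - 1 / q ^ Suc (K + j)"
proof (induction j)
  case (Suc j)
  have "2 * (1 / q ^ Suc (K + Suc j)) \<le> 1 / q ^ Suc (K + j)"
    using q_ge by (simp add: divide_simps)
  then show ?case using Suc by simp
qed auto

text \<open>About \<open>q^(k+1) / k^(3/2)\<close> root edges times \<open>n^2 / q^(2k+2)\<close>
  pairs leave a geometric tail starting below \<open>1 / q^(K+1) <= 1/n\<close>.\<close>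

lemma sum_pairs_le:
  assumes "real n \<le> q ^ Suc K" "K \<le> n"
  shows "(\<Sum>k\<in>{Suc K..n}. degree_sum m k * (2 * (2 * real n + 1) * (real n + 1) / q ^ (2 * k + 2))) \<le>
    12 * real n / (real (Suc K) * sqrt (real (Suc K)))"
proof -
  define M where "M = 2 * (2 * real n + 1) * (real n + 1)"
  define r where "r = 1 / (real (Suc K) * sqrt (real (Suc K)))"
  have "degree_sum m k * (M / q ^ (2 * k + 2)) \<le> (M * r) * (1 / q ^ Suc k)" if "k \<in> {Suc K..n}" for k
  proof -
    have "real (Suc K) * sqrt (real (Suc K)) \<le> real (Suc k) * sqrt (real (Suc k))"
      using that by (intro mult_mono) auto
    then have "1 / (real (Suc k) * sqrt (real (Suc k))) \<le> r"
      unfolding r_def by (intro divide_left_mono) auto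
    then have "q ^ Suc k * (1 / (real (Suc k) * sqrt (real (Suc k)))) \<le> q ^ Suc k * r"
      using q_ge by (intro mult_left_mono) auto
    then have "degree_sum m k \<le> q ^ Suc k * r"
      using degree_sum_le[of k] by simp
    then have "degree_sum m k * (M / q ^ (2 * k + 2)) \<le> q ^ Suc k * r * (M / q ^ (2 * k + 2))"
      using q_ge by (intro mult_right_mono) (auto simp: M_def)
    also have "\<dots> = (M * r) * (1 / q ^ Suc k)"
    proof -
      have "q ^ (2 * k + 2) = q ^ Suc k * q ^ Suc k"
        by (simp add: power_add mult_2)
      then show ?thesis using q_ge by (simp del: power_Suc)
    qed
    finally show ?thesis .
  qed
  then have "(\<Sum>k\<in>{Suc K..n}. degree_sum m k * (M / q ^ (2 * k + 2))) \<le>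
      (\<Sum>k\<in>{Suc K..n}. (M * r) * (1 / q ^ Suc k))"
    by (rule sum_mono)
  also have "\<dots> = M * r * (\<Sum>k\<in>{Suc K..n}. 1 / q ^ Suc k)"
    by (simp add: sum_distrib_left)
  also have "\<dots> \<le> M * r * (1 / real n)"
  proof (rule mult_left_mono)
    have "(\<Sum>k\<in>{Suc K..n}. 1 / q ^ Suc k) \<le> 1 / q ^ Suc K - 1 / q ^ Suc n"
      using sum_inverse_powers[of K "n - K"] assms by simp
    also have "\<dots> \<le> 1 / q ^ Suc K" using q_ge by simp
    also have "\<dots> \<le> 1 / real n"
      using assms n q_ge by (intro divide_left_mono) auto
    finally show "(\<Sum>k\<in>{Suc K..n}. 1 / q ^ Suc k) \<le> 1 / real n" .
  qed (simp add: M_def r_def)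
  also have "\<dots> \<le> (12 * real n) * r"
  proof -
    have "M \<le> 2 * (3 * real n) * (2 * real n)"
      unfolding M_def using n by (intro mult_mono) auto
    then have "M / real n \<le> 12 * real n"
      using n by (simp add: field_simps)
    then have "M / real n * r \<le> 12 * real n * r"
      by (rule mult_right_mono) (simp add: r_def)
    then show ?thesis by simp
  qed
  finally show ?thesis by (simp add: M_def r_def)
qed

text \<open>The expected number of edges of a random tree whose upper end carries a subtree of size
  at most \<open>K\<close>.\<close>

definition small_edges :: "nat \<Rightarrow> real" where
  "small_edges K = (\<Sum>k\<le>K. \<Sum>s\<in>trees_of_size m k. real (length (children s)) *
    (\<Sum>t\<in>trees_of_size m n. occ s t)) / N"

lemma large_edges:
  assumes "K \<le> n"
  shows "(\<Sum>k\<in>{Suc K..n}. \<Sum>s\<in>trees_of_size m k. real (length (children s)) *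
    (\<Sum>t\<in>trees_of_size m n. occ s t)) / N = real n - small_edges K"
  using sum_occ_degrees[of m n] N_pos unfolding sum_atMost_split[OF assms] small_edges_def
  by (simp add: field_simps flip: N_def)

text \<open>A tree of size at most \<open>K\<close> is charged once to every random tree, a larger
  one with its multiplicity.\<close>

lemma avg_upper:
  assumes "K \<le> n"
  shows "avg_dag_edges m n \<le> (\<Sum>k\<le>K. degree_sum m k) + (real n - small_edges K)"
proof -
  have "(\<Sum>t\<in>trees_of_size m n. of_bool (s \<in> subtrees t)) \<le> N" for s
    using sum_mono[of "trees_of_size m n" "\<lambda>t. of_bool (s \<in> subtrees t)" "\<lambda>_. 1::real"] by (simp add: N_def)
  then have "(\<Sum>k\<le>K. \<Sum>s\<in>trees_of_size m k. real (length (children s)) *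
      (\<Sum>t\<in>trees_of_size m n. of_bool (s \<in> subtrees t))) \<le>
      (\<Sum>k\<le>K. \<Sum>s\<in>trees_of_size m k. real (length (children s)) * N)"
    by (intro sum_mono mult_left_mono) auto
  moreover have "(\<Sum>k\<in>{Suc K..n}. \<Sum>s\<in>trees_of_size m k. real (length (children s)) *
      (\<Sum>t\<in>trees_of_size m n. of_bool (s \<in> subtrees t))) \<le>
      (\<Sum>k\<in>{Suc K..n}. \<Sum>s\<in>trees_of_size m k. real (length (children s)) *
      (\<Sum>t\<in>trees_of_size m n. occ s t))"
    by (intro sum_mono mult_left_mono occ_bounds) auto
  ultimately have "(\<Sum>t\<in>trees_of_size m n. real (dag_edges t)) \<le>
      (\<Sum>k\<le>K. degree_sum m k) * N + (\<Sum>k\<in>{Suc K..n}. \<Sum>s\<in>trees_of_size m k. real (length (children s)) *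
      (\<Sum>t\<in>trees_of_size m n. occ s t))"
    unfolding sum_dag_edges sum_atMost_split[OF assms] degree_sum_def sum_distrib_right by linarith
  then have "avg_dag_edges m n \<le> ((\<Sum>k\<le>K. degree_sum m k) * N + (\<Sum>k\<in>{Suc K..n}. \<Sum>s\<in>trees_of_size m k.
      real (length (children s)) * (\<Sum>t\<in>trees_of_size m n. occ s t))) / N"
    unfolding avg_dag_edges_def N_def[symmetric] using N_pos by (intro divide_right_mono) auto
  then show ?thesis
    using large_edges[OF assms] N_pos by (simp add: add_divide_distrib)
qed

text \<open>Trees of size at most \<open>K\<close> are dropped altogether; the larger ones are
  bounded by Bonferroni.\<close>

lemma avg_lower:
  assumes "K \<le> n"
  shows "real n - small_edges K -
    (\<Sum>k\<in>{Suc K..n}. degree_sum m k * (2 * (2 * real n + 1) * (real n + 1) / q ^ (2 * k + 2)))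
    \<le> avg_dag_edges m n"
proof -
  define P where "P k = 2 * (2 * real n + 1) * (real n + 1) / q ^ (2 * k + 2)" for k
  have le: "(\<Sum>t\<in>trees_of_size m n. occ s t) - P k * N \<le> (\<Sum>t\<in>trees_of_size m n. of_bool (s \<in> subtrees t))"
    if "s \<in> trees_of_size m k" for s k
  proof -
    have "(\<Sum>t\<in>trees_of_size m n. occ s t * (occ s t - 1)) \<le> P k * N"
      using pairs_ratio[OF that] N_pos by (simp add: P_def pos_divide_le_eq)
    moreover have "(\<Sum>t\<in>trees_of_size m n. occ s t - occ s t * (occ s t - 1)) \<le>
        (\<Sum>t\<in>trees_of_size m n. of_bool (s \<in> subtrees t))"
      by (intro sum_mono occ_bounds)
    ultimately show ?thesis by (simp only: sum_subtractf)
  qed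
  have "(\<Sum>k\<in>{Suc K..n}. \<Sum>s\<in>trees_of_size m k. real (length (children s)) *
      ((\<Sum>t\<in>trees_of_size m n. occ s t) - P k * N)) \<le>
      (\<Sum>k\<in>{Suc K..n}. \<Sum>s\<in>trees_of_size m k. real (length (children s)) *
      (\<Sum>t\<in>trees_of_size m n. of_bool (s \<in> subtrees t)))"
    by (intro sum_mono mult_left_mono le) auto
  also have "\<dots> \<le> (\<Sum>t\<in>trees_of_size m n. real (dag_edges t))"
    unfolding sum_dag_edges sum_atMost_split[OF assms]
    by (simp only: le_add_same_cancel2) (intro sum_nonneg mult_nonneg_nonneg; simp)
  also have "(\<Sum>k\<in>{Suc K..n}. \<Sum>s\<in>trees_of_size m k. real (length (children s)) *
      ((\<Sum>t\<in>trees_of_size m n. occ s t) - P k * N)) =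
      (\<Sum>k\<in>{Suc K..n}. \<Sum>s\<in>trees_of_size m k. real (length (children s)) *
      (\<Sum>t\<in>trees_of_size m n. occ s t)) - (\<Sum>k\<in>{Suc K..n}. degree_sum m k * P k) * N"
    by (simp only: right_diff_distrib sum_subtractf degree_sum_def sum_distrib_right mult.assoc)
  finally have "((\<Sum>k\<in>{Suc K..n}. \<Sum>s\<in>trees_of_size m k. real (length (children s)) *
      (\<Sum>t\<in>trees_of_size m n. occ s t)) - (\<Sum>k\<in>{Suc K..n}. degree_sum m k * P k) * N) / N
      \<le> avg_dag_edges m n"
    unfolding avg_dag_edges_def N_def[symmetric] using N_pos by (intro divide_right_mono) auto
  then show ?thesis
    using large_edges[OF assms] N_pos by (simp add: diff_divide_distrib P_def)
qed

text \<open>With all quotients \<open>cb (n - k) / cb n\<close> replaced by 1 the sum telescopes to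
  \<open>(n + 1)(1 - R)\<close>. They lie between 1 and \<open>1 + 2K/n\<close>, and
  \<open>1 - R <= 2\<close>, so the replacement costs at most \<open>8K\<close>.\<close>

lemma small_edges_bounds:
  assumes "2 * K \<le> n" "K < n"
  defines "R \<equiv> 4 * cb (K + 2) - cb (K + 1)"
  shows "(real n + 1) * (1 - R) \<le> small_edges K"
    and "small_edges K \<le> (real n + 1) * (1 - R) + 8 * real K"
proof -
  define a where "a k = degree_sum m k / (real m * q ^ k)" for k
  have a_nonneg: "a k \<ge> 0" for k
    using degree_sum_nonneg q_ge by (simp add: a_def)
  have "(\<Sum>k\<le>K. a k) = 4 * (\<Sum>k\<le>K. cb (Suc k) / (real (Suc k) + 1)) - (\<Sum>k\<le>K. cb k / (real k + 1))"
    by (simp add: a_def degree_sum_eq sum_subtractf sum_distrib_left del: of_nat_Suc)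
  \<comment> \<open>Shifting the index leaves out the term for 0, which is 1.\<close>
  also have "(\<Sum>k\<le>K. cb (Suc k) / (real (Suc k) + 1)) = (\<Sum>k\<le>Suc K. cb k / (real k + 1)) - 1"
    by (simp add: sum.atMost_Suc_shift del: of_nat_Suc sum.atMost_Suc)
  finally have A: "(\<Sum>k\<le>K. a k) = 2 * (1 - R)"
    unfolding sum_cb_div by (simp add: R_def)
  have E: "small_edges K = (\<Sum>k\<le>K. (real n + 1) / 2 * a k * (cb (n - k) / cb n))"
  proof -
    have "(\<Sum>s\<in>trees_of_size m k. real (length (children s)) * (\<Sum>t\<in>trees_of_size m n. occ s t)) / N =
        (real n + 1) / 2 * a k * (cb (n - k) / cb n)" if "k \<le> K" for k
    proof -
      have "(\<Sum>s\<in>trees_of_size m k. real (length (children s)) * (\<Sum>t\<in>trees_of_size m n. occ s t)) / N =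
          (\<Sum>s\<in>trees_of_size m k. real (length (children s)) * ((\<Sum>t\<in>trees_of_size m n. occ s t) / N))"
        by (subst sum_divide_distrib) simp
      also have "\<dots> = degree_sum m k * ((real n + 1) / (2 * real m * q ^ k) * (cb (n - k) / cb n))"
        unfolding degree_sum_def sum_distrib_right
        using that assms by (intro sum.cong refl arg_cong2[of _ _ _ _ "(*)"] occ_ratio) auto
      finally show ?thesis by (simp add: a_def mult_ac)
    qed
    then show ?thesis
      unfolding small_edges_def by (subst sum_divide_distrib) simp
  qed
  have ratio: "1 \<le> cb (n - k) / cb n" "cb (n - k) / cb n \<le> 1 + 2 * real K / real n" if "k \<le> K" for k
  proof -
    have "1 + 2 * real k / real n \<le> 1 + 2 * real K / real n"
      using that by (simp add: divide_right_mono)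
    moreover have "cb (n - k) \<le> (1 + 2 * real k / real n) * cb n" "cb n \<le> cb (n - k)"
      using cb_ratio[of k n] that assms n by auto
    ultimately show "1 \<le> cb (n - k) / cb n" "cb (n - k) / cb n \<le> 1 + 2 * real K / real n"
      by (auto simp: pos_divide_le_eq pos_le_divide_eq intro: order_trans mult_right_mono)
  qed
  have "(\<Sum>k\<le>K. (real n + 1) / 2 * a k * 1) \<le> small_edges K"
    unfolding E by (intro sum_mono mult_left_mono ratio) (auto simp: a_nonneg)
  then have "(real n + 1) / 2 * (\<Sum>k\<le>K. a k) \<le> small_edges K"
    by (simp only: mult_1_right sum_distrib_left)
  moreover have "x / 2 * (2 * y) = x * y" for x y :: real
    by simp
  ultimately show "(real n + 1) * (1 - R) \<le> small_edges K"
    unfolding A by metis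
  have "small_edges K \<le> (\<Sum>k\<le>K. (real n + 1) / 2 * a k * (1 + 2 * real K / real n))"
    unfolding E by (intro sum_mono mult_left_mono ratio) (auto simp: a_nonneg)
  also have "\<dots> = (real n + 1) / 2 * (\<Sum>k\<le>K. a k) * (1 + 2 * real K / real n)"
    by (simp only: sum_distrib_left sum_distrib_right)
  also have "\<dots> = (real n + 1) * (1 - R) + (1 - R) * (2 * (real n + 1) / real n) * real K"
    unfolding A using n by (simp add: field_simps)
  also have "(1 - R) * (2 * (real n + 1) / real n) * real K \<le> 2 * 4 * real K"
  proof (intro mult_right_mono mult_mono)
    have "cb (K + 1) \<le> 1" using decseqD[OF decseq_cb, of 0 "K + 1"] by simp
    then show "1 - R \<le> 2" using cb_pos[of "K + 2"] unfolding R_def by linarith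
  qed (use n in \<open>auto simp: field_simps\<close>)
  finally show "small_edges K \<le> (real n + 1) * (1 - R) + 8 * real K" by simp
qed

text \<open>In the constant, \<open>4q\<close> comes from the small trees, 12 from the pairs and 7
  from approximating \<open>R\<close>; 6 bounds \<open>|R| + 1\<close>, and \<open>8L\<close> bounds
  the loss in \<open>small_edges\<close>.\<close>

lemma avg_approx:
  assumes L: "L = ln (real n) / ln q" "L \<ge> 1" and small: "2 * L < real n"
  shows "\<bar>avg_dag_edges m n - 3 * real n / sqrt (pi * L)\<bar> \<le> (4 * q + 19) * real n / (L * sqrt L) + 6 + 8 * L"
proof -
  \<comment> \<open>This choice gives \<open>q^K <= n <= q^(K+1)\<close>, which balances the error
    of the small trees, of order \<open>q^(K+1)\<close>, against that of the pairs, of order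
    \<open>n^2 / q^(K+1)\<close>, both up to the factor \<open>1 / L^(3/2)\<close>.\<close>
  define K where "K = nat \<lfloor>L\<rfloor>"
  define R where "R = 4 * cb (K + 2) - cb (K + 1)"
  define y where "y = real (Suc K) * sqrt (real (Suc K))"
  define Y where "Y = L * sqrt L"
  have K: "real K \<le> L" "L \<le> real K + 1"
    using L by (auto simp: K_def)
  have Kn: "2 * K \<le> n" "K < n" "K \<le> n"
    using K small L by linarith+
  have lnq: "ln q > 0" using q_ge by simp
  have qL: "q powr L = real n"
    using lnq n q_ge unfolding L powr_def by simp
  have "q ^ K \<le> real n"
    using powr_mono[OF K(1), of q] q_ge by (simp add: qL powr_realpow)
  have "real n \<le> q ^ Suc K"
    using powr_mono[OF K(2), of q] q_ge powr_realpow[of q "Suc K"] by (simp add: qL add.commute)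
  have Y: "Y > 0" "Y \<le> y"
    unfolding Y_def y_def using K L(2) by (auto intro!: mult_mono)
  have small_sum: "(\<Sum>k\<le>K. degree_sum m k) \<le> 4 * q * real n / Y"
  proof -
    have "(\<Sum>k\<le>K. degree_sum m k) \<le> 4 * (q ^ Suc K / y)"
      unfolding y_def by (rule sum_degree_sum_le)
    also have "\<dots> \<le> 4 * (q * real n / Y)"
      using Y q_ge \<open>q ^ K \<le> real n\<close> by (intro mult_left_mono frac_le) auto
    finally show ?thesis by simp
  qed
  have pairs: "(\<Sum>k\<in>{Suc K..n}. degree_sum m k * (2 * (2 * real n + 1) * (real n + 1) / q ^ (2 * k + 2))) \<le>
      12 * real n / Y"
  proof -
    have "12 * real n / y \<le> 12 * real n / Y"
      using Y by (intro divide_left_mono) auto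
    then show ?thesis
      using sum_pairs_le[OF \<open>real n \<le> q ^ Suc K\<close> Kn(3)] by (simp add: y_def)
  qed
  have R_le: "\<bar>R\<bar> \<le> 5"
  proof -
    have "cb (K + 1) \<le> 1" "cb (K + 2) \<le> 1"
      using decseqD[OF decseq_cb, of 0 "K + 1"] decseqD[OF decseq_cb, of 0 "K + 2"] by simp_all
    then show ?thesis
      using cb_pos[of "K + 1"] cb_pos[of "K + 2"] unfolding R_def by linarith
  qed
  \<comment> \<open>The coefficients 4 and -1 in \<open>R\<close> give the leading factor 3 and five
    times the error of \<open>cb_approx\<close>.\<close>
  have "\<bar>R - 3 * (1 / sqrt (pi * L))\<bar> \<le> 25 / (4 * Y)"
  proof -
    have "\<bar>cb (K + 1) - 1 / sqrt (pi * L)\<bar> \<le> 5 / (4 * Y)" "\<bar>cb (K + 2) - 1 / sqrt (pi * L)\<bar> \<le> 5 / (4 * Y)"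
      unfolding Y_def by (rule cb_approx; use K L(2) in simp)+
    moreover have "25 / (4 * Y) = 5 * (5 / (4 * Y))" by simp
    ultimately show ?thesis unfolding R_def by linarith
  qed
  then have "real n * \<bar>R - 3 * (1 / sqrt (pi * L))\<bar> \<le> real n * (25 / (4 * Y))"
    by (rule mult_left_mono) simp
  also have "\<dots> \<le> 7 * real n / Y"
    using Y by (simp add: divide_simps)
  finally have *: "real n * \<bar>R - 3 * (1 / sqrt (pi * L))\<bar> \<le> 7 * real n / Y" .
  have R: "\<bar>real n * R - 3 * real n / sqrt (pi * L)\<bar> \<le> 7 * real n / Y"
  proof -
    have "real n * R - 3 * real n / sqrt (pi * L) = real n * (R - 3 * (1 / sqrt (pi * L)))"
      by (simp add: right_diff_distrib)
    then have "\<bar>real n * R - 3 * real n / sqrt (pi * L)\<bar> = real n * \<bar>R - 3 * (1 / sqrt (pi * L))\<bar>"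
      by (simp add: abs_mult)
    then show ?thesis using * by simp
  qed
  have "real n - small_edges K \<le> real n * R + R - 1"
    "real n * R + R - 1 - 8 * real K \<le> real n - small_edges K"
    using small_edges_bounds[OF Kn(1,2)] unfolding R_def[symmetric] by (auto simp: algebra_simps)
  then have "avg_dag_edges m n \<le> 3 * real n / sqrt (pi * L) + 4 * q * real n / Y + 7 * real n / Y + 6"
    "avg_dag_edges m n \<ge> 3 * real n / sqrt (pi * L) - 12 * real n / Y - 7 * real n / Y - 6 - 8 * L"
    using avg_upper[OF Kn(3)] avg_lower[OF Kn(3)] small_sum pairs R R_le K by linarith+
  moreover have "(4 * q + 19) * real n / Y = 4 * q * real n / Y + 7 * real n / Y + 12 * real n / Y"
    by (simp add: add_divide_distrib distrib_right)
  moreover have "4 * q * real n / Y \<ge> 0" "12 * real n / Y \<ge> 0"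
    using Y q_ge by auto
  ultimately show ?thesis
    using L unfolding Y_def[symmetric] by linarith
qed

end

section \<open>Passage to the asymptotic formula\<close>

theorem theorem10:
  fixes m :: nat
  assumes "m \<ge> 1"
  shows "\<exists>h :: nat \<Rightarrow> real. h \<in> O(\<lambda>n. 1 / ln (real n)) \<and>
    (\<forall>\<^sub>F n in at_top. avg_dag_edges m n =
        3 * kappa m * (real n / sqrt (ln (real n))) * (1 + h n))"
proof -
  define c where "c = ln (4 * real m)"
  define main where "main n = 3 * kappa m * (real n / sqrt (ln (real n)))" for n
  define h where "h n = avg_dag_edges m n / main n - 1" for n
  \<comment> \<open>The 20 is 19 plus 1 for absorbing \<open>6 + 8L\<close>; the factor
    \<open>sqrt pi / 3\<close> comes from dividing by
    \<open>main n = 3n / sqrt (pi L)\<close>.\<close>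
  define C where "C = (4 * (4 * real m) + 20) * sqrt pi / 3"
  have c: "c > 0" using assms by (simp add: c_def)
  have "\<forall>\<^sub>F n in at_top. 6 + 8 * (ln (real n) / c) \<le> real n / (ln (real n) / c * sqrt (ln (real n) / c))"
    using c by real_asymp
  moreover have "\<forall>\<^sub>F n in at_top. 2 * (ln (real n) / c) < real n"
    using c by real_asymp
  moreover have "\<forall>\<^sub>F n in at_top. ln (real n) / c \<ge> 1"
    using c by real_asymp
  ultimately have ev: "\<forall>\<^sub>F n in at_top. main n > 0 \<and> \<bar>h n\<bar> \<le> C * c * (1 / ln (real n))"
    using eventually_gt_at_top[of 0]
  proof eventually_elim
    case (elim n)
    define L where "L = ln (real n) / c"
    interpret dag_average m n
      by standard (use elim assms in auto)
    have L: "L \<ge> 1" "ln (real n) = L * c" using elim c by (auto simp: L_def)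
    \<comment> \<open>Here \<open>kappa m\<close> is \<open>sqrt (c / pi)\<close>, and its
      \<open>c\<close> cancels against that in \<open>ln n = L c\<close>.\<close>
    have main: "main n = 3 * real n / sqrt (pi * L)"
      using L c by (simp add: main_def kappa_def real_sqrt_mult real_sqrt_divide flip: c_def)
    have pos: "main n > 0" using L elim by (simp add: main)
    have "\<bar>avg_dag_edges m n - main n\<bar> \<le> (4 * q + 19) * real n / (L * sqrt L) + 6 + 8 * L"
      unfolding main using elim by (intro avg_approx) (auto simp: L_def c_def q_def)
    also have "\<dots> \<le> (4 * q + 20) * real n / (L * sqrt L)"
      using elim by (simp add: distrib_right add_divide_distrib flip: L_def)
    also have "\<dots> = C / L * main n"
      using L by (simp add: C_def main q_def real_sqrt_mult)
    finally have "\<bar>avg_dag_edges m n - main n\<bar> / main n \<le> C / L"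
      using pos by (simp add: pos_divide_le_eq)
    moreover have "\<bar>h n\<bar> = \<bar>avg_dag_edges m n - main n\<bar> / main n"
      using pos by (simp add: h_def diff_divide_distrib flip: abs_divide) (simp add: field_simps)
    moreover have "C / L = C * c * (1 / ln (real n))"
      using L c by simp
    ultimately show ?case
      using pos by simp
  qed
  have "h \<in> O(\<lambda>n. 1 / ln (real n))"
  proof (rule bigoI)
    show "\<forall>\<^sub>F n in at_top. norm (h n) \<le> (C * c) * norm (1 / ln (real n))"
      using ev eventually_gt_at_top[of 1] by eventually_elim simp
  qed
  moreover have "\<forall>\<^sub>F n in at_top. avg_dag_edges m n = main n * (1 + h n)"
    using ev by eventually_elim (simp add: h_def)
  ultimately show ?thesis
    unfolding main_def by blast
qed

end
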